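(* For $n\ge0$ let $v_1(n)$ be the number of permutations of $[n]$ containing exactly one occurrence of the pattern $1\text{-}32$, and let $B_n$ be the $n$th Bell number. Then $v_1(0)=0$ and, for every $n\ge 0$, $$v_1(n+1)=v_1(n)+\sum_{k=1}^{n-1}\left[\binom{n}{k}v_1(k)+\binom{n-1}{k-1}B_k\right].$$
   Context: An occurrence of the pattern $1\text{-}32$ in a permutation $\pi=a_1a_2\cdots a_n$ of $[n]$ is a pair of indices $(i,j)$ with $1\le i<j<n$ such that $a_i<a_{j+1}<a_j$ (the last two letters adjacent in $\pi$). $B_n$ denotes the $n$th Bell number ($B_0=1,B_1=1,B_2=2,B_3=5,\dots$). *)

theory Defs
  imports "HOL-Combinatorics.Permutations" "HOL-Library.Disjoint_Sets"
begin

definition occ_1_32 :: "nat \<Rightarrow> (nat \<Rightarrow> nat) \<Rightarrow> (nat \<times> nat) set" where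
  "occ_1_32 n \<pi> = {(i, j). 1 \<le> i \<and> i < j \<and> j < n \<and> \<pi> i < \<pi> (j + 1) \<and> \<pi> (j + 1) < \<pi> j}"

definition v1 :: "nat \<Rightarrow> nat" where
  "v1 n = card {\<pi>. \<pi> permutes {1..n} \<and> card (occ_1_32 n \<pi>) = 1}"

definition Bell :: "nat \<Rightarrow> nat" where
  "Bell n = card {P. partition_on {1..n} P}"

end

theory Submission
  imports Defs "HOL-Combinatorics.Multiset_Permutations" "HOL-Library.Infinite_Set"
begin

text \<open>
  Write a permutation of \<open>{1..n + 1}\<close> as \<open>\<sigma> 1 \<tau>\<close>. Each descent of \<open>\<tau>\<close> forms an occurrence with the
  letter \<open>1\<close>, so the permutation avoids the pattern iff \<open>\<sigma>\<close> does and \<open>\<tau>\<close> is increasing; this is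
  the recurrence of the Bell numbers, \<open>U\<close> being the set of letters of \<open>\<sigma>\<close> on one side and the
  complement of the block of the minimum on the other. There is exactly one occurrence iff either
  \<open>\<tau>\<close> is increasing and \<open>\<sigma>\<close> contains exactly one, or \<open>\<sigma>\<close> avoids the pattern and \<open>\<tau>\<close> has the
  form \<open>\<alpha> 2 \<beta>\<close> with \<open>\<alpha>\<close> and \<open>\<beta>\<close> increasing and \<open>\<alpha>\<close> nonempty. In the latter case
  \<open>\<sigma> 2 \<beta>\<close> is an arbitrary avoiding word on a proper subset of \<open>{2..n + 1}\<close> containing \<open>2\<close>;
  with \<open>k\<close> letters there are \<open>(n - 1) choose (k - 1)\<close> such subsets and \<open>Bell k\<close> words on each.
\<close>

section \<open>Occurrences in words\<close>

fun descents_above :: "'a::linorder \<Rightarrow> 'a list \<Rightarrow> nat" where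
  "descents_above a (x # y # zs) = of_bool (a < y \<and> y < x) + descents_above a (y # zs)"
| "descents_above a _ = 0"

text \<open>Occurrences are grouped by the letter playing the role of 1, which makes the count
  structurally recursive; \<open>occs_eq_card\<close> identifies it with the count of index
  pairs.\<close>

fun occs :: "'a::linorder list \<Rightarrow> nat" where
  "occs [] = 0"
| "occs (x # xs) = descents_above x xs + occs xs"

lemma descents_above_Cons_less:
  assumes "\<forall>y\<in>set xs. m < y"
  shows "descents_above a (m # xs) = descents_above a xs"
  using assms by (cases xs) auto

text \<open>The minimum \<open>m\<close> creates exactly one descent, from the last letter of
  \<open>xs\<close> into \<open>m\<close>, and starts none.\<close>

lemma descents_above_append_min:
  assumes "\<forall>x\<in>set xs \<union> set ys. m < x"
  shows "descents_above a (xs @ m # ys) =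
    descents_above a xs + of_bool (xs \<noteq> [] \<and> a < m) + descents_above a ys"
  using assms
proof (induction xs)
  case Nil
  then show ?case by (simp add: descents_above_Cons_less)
next
  case (Cons x xs)
  then show ?case by (cases xs) (auto simp: descents_above_Cons_less)
qed

text \<open>No letter of \<open>xs\<close> lies below \<open>m\<close>, so the descent into
  \<open>m\<close> completes no occurrence. The others are sorted by whether they lie within
  \<open>xs\<close>, join \<open>xs\<close> to a descent of \<open>ys\<close>, or start at
  \<open>m\<close> or later.\<close>

lemma occs_append_min:
  assumes "\<forall>x\<in>set xs \<union> set ys. m < x"
  shows "occs (xs @ m # ys) =
    occs xs + (\<Sum>a\<leftarrow>xs. descents_above a ys) + (descents_above m ys + occs ys)"
  using assms
proof (induction xs)
  case (Cons x xs)
  then have "\<not> x < m" by auto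
  with Cons show ?case by (simp add: descents_above_append_min)
qed simp

lemma descents_above_eq_0_sorted: "sorted xs \<Longrightarrow> descents_above a xs = 0"
  by (induction a xs rule: descents_above.induct) auto

text \<open>With \<open>a\<close> below all letters the lower bound is vacuous, so every descent is
  counted.\<close>

lemma sorted_if_descents_above_eq_0:
  assumes "descents_above a xs = 0" "\<forall>x\<in>set xs. a < x"
  shows "sorted xs"
  using assms
proof (induction a xs rule: descents_above.induct)
  case (1 a x y zs)
  then show ?case
    by (smt (verit) add_is_0 descents_above.simps(1) dual_order.trans linorder_not_less list.set_intros(1,2)
        of_bool_eq_0_iff set_ConsD sorted2)
qed auto

lemma descents_above_cong:
  assumes "\<forall>x\<in>set xs. a < x \<and> b < x"
  shows "descents_above a xs = descents_above b xs"
  using assms by (induction a xs rule: descents_above.induct) auto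

lemma occs_sorted: "sorted xs \<Longrightarrow> occs xs = 0"
  by (induction xs) (auto simp: descents_above_eq_0_sorted)

lemma occs_append_min_eq_0_iff:
  assumes "\<forall>x\<in>set xs \<union> set ys. m < x"
  shows "occs (xs @ m # ys) = 0 \<longleftrightarrow> occs xs = 0 \<and> sorted ys"
  using assms sorted_if_descents_above_eq_0[of m ys]
  by (auto simp: occs_append_min descents_above_eq_0_sorted occs_sorted)

text \<open>A single descent of \<open>ys\<close> already forms an occurrence with \<open>m\<close>, so it must form none with
  \<open>xs\<close> or with an earlier letter of \<open>ys\<close>: its bottom is the second smallest letter \<open>m'\<close>.\<close>

lemma occs_append_min_eq_1_iff:
  assumes m: "\<forall>x\<in>set xs \<union> set ys. m < x"
    and m': "m' \<in> set xs \<union> set ys" "\<forall>x\<in>set xs \<union> set ys. m' \<le> x"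
    and "distinct (xs @ ys)"
  shows "occs (xs @ m # ys) = 1 \<longleftrightarrow>
    occs xs = 1 \<and> sorted ys \<or>
    occs xs = 0 \<and> (\<exists>us vs. ys = us @ m' # vs \<and> us \<noteq> [] \<and> sorted us \<and> sorted vs)"
    (is "?L \<longleftrightarrow> ?A \<or> ?B")
proof
  assume L: ?L
  show "?A \<or> ?B"
  proof (cases "sorted ys")
    case True
    then show ?thesis
      using L m by (simp add: occs_append_min descents_above_eq_0_sorted occs_sorted)
  next
    case False
    then have "descents_above m ys \<noteq> 0"
      using m sorted_if_descents_above_eq_0[of m ys] by auto
    moreover have "occs xs + (\<Sum>a\<leftarrow>xs. descents_above a ys) + (descents_above m ys + occs ys) = 1"
      using L m by (simp add: occs_append_min)
    ultimately have d: "descents_above m ys = 1" "occs xs = 0"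
      and "(\<Sum>a\<leftarrow>xs. descents_above a ys) = 0"
      by linarith+
    then have d3: "\<forall>a\<in>set xs. descents_above a ys = 0"
      by simp
    have "m' \<notin> set xs"
    proof
      assume *: "m' \<in> set xs"
      \<comment> \<open>All letters of \<open>ys\<close> exceed \<open>m'\<close>, so the descent
        seen by \<open>m\<close> would form a second occurrence with \<open>m'\<close>.\<close>
      have "descents_above m ys = descents_above m' ys"
        using m m'(2) * assms(4) by (intro descents_above_cong) (auto simp: le_less)
      then show False using d d3 * by simp
    qed
    then obtain us vs where ys: "ys = us @ m' # vs"
      using m'(1) by (auto dest: split_list)
    have "m < m'" and lt: "\<forall>x\<in>set us \<union> set vs. m' < x"
      using m m' assms(4) ys by (auto simp: le_less)
    then have e: "descents_above m us + of_bool (us \<noteq> []) + descents_above m vs = 1"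
      using d(1) by (simp add: ys descents_above_append_min)
    \<comment> \<open>Otherwise the descent counted in \<open>e\<close> lies in \<open>vs\<close>,
      where it also forms an occurrence with \<open>m'\<close>.\<close>
    have "us \<noteq> []"
    proof
      assume "us = []"
      then have "occs (m' # vs) = 0"
        using L m d ys by (simp add: occs_append_min)
      then have "descents_above m' vs = 0" by simp
      moreover have "descents_above m' vs = descents_above m vs"
        using lt m ys by (intro descents_above_cong) auto
      ultimately show False using e \<open>us = []\<close> by simp
    qed
    with e have "descents_above m us = 0" "descents_above m vs = 0" by auto
    then have "sorted us" "sorted vs"
      using m ys by (auto intro!: sorted_if_descents_above_eq_0[of m])
    with \<open>us \<noteq> []\<close> d(2) ys show ?thesis by auto
  qed
next
  assume "?A \<or> ?B"
  then show ?L
  proof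
    assume ?A
    then show ?L
      using m by (simp add: occs_append_min descents_above_eq_0_sorted occs_sorted)
  next
    assume ?B
    then obtain us vs where B: "occs xs = 0" "ys = us @ m' # vs" "us \<noteq> []" "sorted us" "sorted vs"
      by auto
    have "m < m'" and lt: "\<forall>x\<in>set us \<union> set vs. m' < x"
      using m m' assms(4) B by (auto simp: le_less)
    have "descents_above m ys = 1"
      using B lt \<open>m < m'\<close> by (simp add: descents_above_append_min descents_above_eq_0_sorted)
    \<comment> \<open>The only descent of \<open>ys\<close> ends in \<open>m'\<close>, which is not
      above any letter of \<open>xs\<close>.\<close>
    moreover have "descents_above a ys = 0" if "a \<in> set xs" for a
      using B lt m'(2) that
      by (auto simp: descents_above_append_min descents_above_eq_0_sorted not_less)
    moreover have "occs ys = 0"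
      using B lt occs_append_min_eq_0_iff[of us vs m'] by (simp add: occs_sorted)
    ultimately show ?L
      using m B(1) by (simp add: occs_append_min cong: map_cong)
  qed
qed

section \<open>Recurrences for words over a finite alphabet\<close>

text \<open>Alphabets are arbitrary sets rather than initial segments because the recurrences pass
  to arbitrary subsets of the letters.\<close>

definition words :: "nat \<Rightarrow> 'a::linorder set \<Rightarrow> 'a list set" where
  "words c A = {xs \<in> permutations_of_set A. occs xs = c}"

lemma mem_words_iff: "xs \<in> words c A \<longleftrightarrow> distinct xs \<and> set xs = A \<and> occs xs = c"
  by (auto simp: words_def permutations_of_set_def)

lemma finite_words [simp]: "finite (words c A)"
  by (simp add: words_def)

text \<open>The letter \<open>m\<close> occurs once, so the word can be cut there; the prefix is
  \<open>xs\<close> and its letters form \<open>U\<close>. Leaving \<open>c\<close> general serves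
  both recurrences.\<close>

lemma card_image_append_sorted:
  fixes A :: "'a::linorder set"
  assumes "finite A" "m \<notin> A"
  shows "card ((\<lambda>(U, xs). xs @ m # sorted_list_of_set (A - U)) ` (SIGMA U:Pow A. words c U)) =
    (\<Sum>U\<in>Pow A. card (words c U))"
proof -
  have "inj_on (\<lambda>(U, xs). xs @ m # sorted_list_of_set (A - U)) (SIGMA U:Pow A. words c U)"
  proof (rule inj_onI, clarify)
    fix U xs V ys
    assume "U \<subseteq> A" "xs \<in> words c U" "V \<subseteq> A" "ys \<in> words c V"
      and eq: "xs @ m # sorted_list_of_set (A - U) = ys @ m # sorted_list_of_set (A - V)"
    then have "m \<notin> set xs" "m \<notin> set ys" "U = set xs" "V = set ys"
      using assms by (auto simp: mem_words_iff)
    moreover have "m \<notin> set (sorted_list_of_set (A - U))"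
      using assms by simp
    ultimately show "U = V \<and> xs = ys"
      using eq by (simp add: append_Cons_eq_iff)
  qed
  then show ?thesis
    using assms by (simp add: card_image card_SigmaI)
qed

lemma words_0_insert_min:
  assumes "finite A" "\<forall>x\<in>A. m < x"
  shows "words 0 (insert m A) =
    (\<lambda>(U, xs). xs @ m # sorted_list_of_set (A - U)) ` (SIGMA U:Pow A. words 0 U)" (is "_ = ?R")
proof (intro equalityI subsetI)
  fix zs assume zs: "zs \<in> words 0 (insert m A)"
  then obtain xs ys where s: "zs = xs @ m # ys"
    by (metis insertI1 mem_words_iff split_list)
  with zs assms have *: "distinct xs" "distinct ys" "set xs \<union> set ys = A" "set xs \<inter> set ys = {}"
    by (auto simp: mem_words_iff)
  then have "occs xs = 0" "sorted ys"
    using zs s assms occs_append_min_eq_0_iff[of xs ys m] by (auto simp: mem_words_iff)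
  \<comment> \<open>An increasing suffix is determined by its letters, so \<open>xs\<close> alone
    encodes the word.\<close>
  moreover have "ys = sorted_list_of_set (A - set xs)"
    using * \<open>sorted ys\<close> assms by (intro sorted_distinct_set_unique) auto
  ultimately show "zs \<in> ?R"
    using s * by (auto intro!: image_eqI[of _ _ "(set xs, xs)"] simp: mem_words_iff)
next
  fix zs assume "zs \<in> ?R"
  then obtain U xs where "U \<subseteq> A" "xs \<in> words 0 U" "zs = xs @ m # sorted_list_of_set (A - U)"
    by auto
  then show "zs \<in> words 0 (insert m A)"
    using assms occs_append_min_eq_0_iff[of xs "sorted_list_of_set (A - U)" m]
    by (auto simp: mem_words_iff)
qed

lemma card_words_0_insert_min:
  assumes "finite A" "\<forall>x\<in>A. m < x"
  shows "card (words 0 (insert m A)) = (\<Sum>U\<in>Pow A. card (words 0 U))"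
  using assms words_0_insert_min[OF assms] card_image_append_sorted[of A m 0] by auto

text \<open>\<open>U\<close> holds the letters before \<open>m\<close>, and \<open>V\<close> those
  together with the letters after \<open>m'\<close>. Cutting at \<open>m\<close> and then at
  \<open>m'\<close> recovers \<open>xs\<close>, \<open>A - V\<close> and hence
  \<open>V\<close>.\<close>

lemma card_image_append_two_sorted:
  fixes A :: "'a::linorder set"
  assumes "finite A" "m \<notin> insert m' A" "m' \<notin> A"
  shows "card ((\<lambda>(V, U, xs). xs @ m # sorted_list_of_set (A - V) @ m' # sorted_list_of_set (V - U)) `
      (SIGMA V:Pow A - {A}. SIGMA U:Pow V. words 0 U)) =
    (\<Sum>V\<in>Pow A - {A}. \<Sum>U\<in>Pow V. card (words 0 U))"
proof -
  have fin: "finite V" if "V \<in> Pow A - {A}" for V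
    using that assms finite_subset by auto
  have "inj_on (\<lambda>(V, U, xs). xs @ m # sorted_list_of_set (A - V) @ m' # sorted_list_of_set (V - U))
    (SIGMA V:Pow A - {A}. SIGMA U:Pow V. words 0 U)"
  proof (rule inj_onI)
    fix p q
    let ?t = "\<lambda>V U. sorted_list_of_set (A - V) @ m' # sorted_list_of_set (V - U)"
    let ?f = "\<lambda>(V, U, xs). xs @ m # ?t V U"
    let ?S = "SIGMA V:Pow A - {A}. SIGMA U:Pow V. words 0 U"
    assume "p \<in> ?S" "q \<in> ?S" "?f p = ?f q"
    moreover obtain V U xs V' U' xs' where pq: "p = (V, U, xs)" "q = (V', U', xs')"
      by (metis prod_cases3)
    ultimately have *: "V \<subseteq> A" "U \<subseteq> V" "xs \<in> words 0 U" "V' \<subseteq> A" "U' \<subseteq> V'" "xs' \<in> words 0 U'"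
      and eq: "xs @ m # ?t V U = xs' @ m # ?t V' U'"
      by auto
    then have fV: "finite V" "finite V'"
      using assms finite_subset by auto
    have U: "U = set xs" "U' = set xs'"
      using * by (auto simp: mem_words_iff)
    have "m \<notin> set xs" "m \<notin> set (?t V U)"
      using * U fV assms by auto
    with eq have 1: "xs = xs'" "?t V U = ?t V' U'"
      by (simp_all add: append_Cons_eq_iff del: set_append set_simps set_sorted_list_of_set)
    have "m' \<notin> set (sorted_list_of_set (A - V))" "m' \<notin> set (sorted_list_of_set (V - U))"
      using * fV assms by auto
    with 1(2) have "sorted_list_of_set (A - V) = sorted_list_of_set (A - V')"
      by (simp add: append_Cons_eq_iff del: set_sorted_list_of_set)
    then have "A - V = A - V'"
      using assms by (metis finite_Diff set_sorted_list_of_set)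
    then have "V = V'"
      using * by blast
    with 1 U pq show "p = q" by simp
  qed
  then show ?thesis
    using assms fin by (simp add: card_image card_SigmaI finite_SigmaI)
qed

text \<open>In the first class the occurrence lies inside the prefix before \<open>m\<close>; in the
  second it consists of \<open>m\<close> and the descent into \<open>m'\<close>. There
  \<open>V\<close> is a proper subset because \<open>A - V\<close> is the nonempty run before
  \<open>m'\<close>.\<close>

lemma words_1_insert_min:
  assumes "finite A" "m < m'" "\<forall>x\<in>A. m' < x"
  shows "words 1 (insert m (insert m' A)) =
    (\<lambda>(U, xs). xs @ m # sorted_list_of_set (insert m' A - U)) `
      (SIGMA U:Pow (insert m' A). words 1 U) \<union>
    (\<lambda>(V, U, xs). xs @ m # sorted_list_of_set (A - V) @ m' # sorted_list_of_set (V - U)) `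
      (SIGMA V:Pow A - {A}. SIGMA U:Pow V. words 0 U)" (is "_ = ?R \<union> ?S")
proof -
  have lt: "\<forall>x\<in>insert m' A. m < x" and le: "\<forall>x\<in>insert m' A. m' \<le> x"
    using assms by force+
  have m: "m \<notin> insert m' A" "m' \<notin> A"
    using assms by auto
  have occs_1: "occs (xs @ m # ys) = 1 \<longleftrightarrow>
      occs xs = 1 \<and> sorted ys \<or>
      occs xs = 0 \<and> (\<exists>us vs. ys = us @ m' # vs \<and> us \<noteq> [] \<and> sorted us \<and> sorted vs)"
    if "set xs \<union> set ys = insert m' A" "distinct (xs @ ys)" for xs ys
    by (rule occs_append_min_eq_1_iff) (use lt le that in blast)+
  show ?thesis
  proof (intro equalityI subsetI)
    fix zs assume zs: "zs \<in> words 1 (insert m (insert m' A))"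
    then obtain xs ys where s: "zs = xs @ m # ys"
      by (metis insertI1 mem_words_iff split_list)
    with zs have d: "distinct (xs @ m # ys)" "insert m (set xs \<union> set ys) = insert m (insert m' A)"
      "occs (xs @ m # ys) = 1"
      by (auto simp: mem_words_iff)
    then have "m \<notin> set xs \<union> set ys" by simp
    with d(2) m(1) have "set xs \<union> set ys = insert m' A"
      by (metis insert_ident)
    with d(1) have *: "distinct xs" "distinct ys" "set xs \<union> set ys = insert m' A"
      "set xs \<inter> set ys = {}"
      by auto
    with d(3) consider "occs xs = 1" "sorted ys"
      | us vs where "occs xs = 0" "ys = us @ m' # vs" "us \<noteq> []" "sorted us" "sorted vs"
      using occs_1[of xs ys] by auto
    then show "zs \<in> ?R \<union> ?S"
    proof cases
      case 1
      have "ys = sorted_list_of_set (insert m' A - set xs)"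
        using * 1 assms by (intro sorted_distinct_set_unique) auto
      then have "zs \<in> ?R"
        using s * 1 by (auto intro!: image_eqI[of _ _ "(set xs, xs)"] simp: mem_words_iff)
      then show ?thesis ..
    next
      case 2
      let ?V = "A - set us"
      have us: "us = sorted_list_of_set (A - ?V)"
        using * 2 m assms by (intro sorted_distinct_set_unique) auto
      have vs: "vs = sorted_list_of_set (?V - set xs)"
        using * 2 m assms by (intro sorted_distinct_set_unique) auto
      have "set us \<subseteq> A" "set xs \<subseteq> ?V"
        using * 2 m by auto
      moreover obtain u where "u \<in> set us"
        using hd_in_set[OF 2(3)] by blast
      ultimately have "?V \<in> Pow A - {A}" "set xs \<in> Pow ?V"
        by auto
      moreover have "xs \<in> words 0 (set xs)"
        using * 2 by (simp add: mem_words_iff)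
      moreover have "zs = xs @ m # sorted_list_of_set (A - ?V) @ m' # sorted_list_of_set (?V - set xs)"
        using s 2(2) us vs by simp
      ultimately have "zs \<in> ?S"
        by (intro image_eqI[of _ _ "(?V, set xs, xs)"]) auto
      then show ?thesis ..
    qed
  next
    fix zs assume "zs \<in> ?R \<union> ?S"
    then show "zs \<in> words 1 (insert m (insert m' A))"
    proof
      assume "zs \<in> ?R"
      then obtain U xs where *: "U \<subseteq> insert m' A" "xs \<in> words 1 U"
        "zs = xs @ m # sorted_list_of_set (insert m' A - U)"
        by auto
      let ?ys = "sorted_list_of_set (insert m' A - U)"
      have ys: "set ?ys = insert m' A - U" "distinct ?ys" "sorted ?ys"
        using assms(1) by auto
      have "set xs = U" "distinct xs" "occs xs = 1"
        using * by (auto simp: mem_words_iff)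
      moreover from this have "occs (xs @ m # ?ys) = 1"
        using * ys by (subst occs_1) auto
      ultimately show ?thesis
        using m * ys by (auto simp: mem_words_iff)
    next
      assume "zs \<in> ?S"
      then obtain V U xs where *: "V \<subseteq> A" "V \<noteq> A" "U \<subseteq> V" "xs \<in> words 0 U"
        "zs = xs @ m # sorted_list_of_set (A - V) @ m' # sorted_list_of_set (V - U)"
        by auto
      let ?us = "sorted_list_of_set (A - V)" and ?vs = "sorted_list_of_set (V - U)"
      have "finite V"
        by (rule finite_subset[OF *(1) assms(1)])
      then have s: "set ?us = A - V" "set ?vs = V - U" "distinct ?us" "distinct ?vs"
          "sorted ?us" "sorted ?vs"
        using assms(1) by auto
      have "?us \<noteq> []"
        using * s(1) by force
      have x: "set xs = U" "distinct xs" "occs xs = 0"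
        using * by (auto simp: mem_words_iff)
      have "set xs \<union> set (?us @ m' # ?vs) = insert m' A" "distinct (xs @ ?us @ m' # ?vs)"
        using * x m s by auto
      moreover from this have "occs (xs @ m # ?us @ m' # ?vs) = 1"
        using x s \<open>?us \<noteq> []\<close> by (subst occs_1) blast+
      ultimately show ?thesis
        using m x s *(1,3,5) by (auto simp: mem_words_iff)
    qed
  qed
qed

text \<open>The inner sum over \<open>U\<close> is the recurrence for avoiding words read backwards,
  so the second class is counted by avoiding words over \<open>insert m' V\<close>.\<close>

lemma card_words_1_insert_min:
  fixes A :: "'a::linorder set"
  assumes "finite A" "m < m'" "\<forall>x\<in>A. m' < x"
  shows "card (words 1 (insert m (insert m' A))) =
    (\<Sum>U\<in>Pow (insert m' A). card (words 1 U)) + (\<Sum>V\<in>Pow A - {A}. card (words 0 (insert m' V)))"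
proof -
  let ?R = "(\<lambda>(U, xs). xs @ m # sorted_list_of_set (insert m' A - U)) `
      (SIGMA U:Pow (insert m' A). words 1 U)"
  let ?S = "(\<lambda>(V, U, xs). xs @ m # sorted_list_of_set (A - V) @ m' # sorted_list_of_set (V - U)) `
      (SIGMA V:Pow A - {A}. SIGMA U:Pow V. words 0 U)"
  have m: "m \<notin> insert m' A" "m' \<notin> A"
    using assms by auto
  have fin: "finite V" if "V \<in> Pow A - {A}" for V
    using that assms finite_subset by auto
  \<comment> \<open>The prefix before \<open>m\<close> contains one occurrence in the first class
    and none in the second.\<close>
  have "?R \<inter> ?S = {}"
  proof (rule ccontr)
    assume "?R \<inter> ?S \<noteq> {}"
    then obtain U xs V U' xs' where *: "U \<subseteq> insert m' A" "xs \<in> words 1 U" "xs' \<in> words 0 U'"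
      and eq: "xs @ m # sorted_list_of_set (insert m' A - U) =
        xs' @ m # sorted_list_of_set (A - V) @ m' # sorted_list_of_set (V - U')"
      by fastforce
    have "m \<notin> set xs" "m \<notin> set (sorted_list_of_set (insert m' A - U))"
      using * m assms by (auto simp: mem_words_iff)
    with eq have "xs = xs'"
      by (simp add: append_Cons_eq_iff del: set_sorted_list_of_set)
    with * show False by (simp add: mem_words_iff)
  qed
  moreover have "finite ?R" "finite ?S"
    using assms fin by (auto intro!: finite_imageI finite_SigmaI intro: finite_subset)
  ultimately have "card (words 1 (insert m (insert m' A))) = card ?R + card ?S"
    unfolding words_1_insert_min[OF assms] by (intro card_Un_disjoint)
  moreover have "(\<Sum>U\<in>Pow V. card (words 0 U)) = card (words 0 (insert m' V))"
    if "V \<in> Pow A - {A}" for V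
    using that assms fin[OF that] by (intro card_words_0_insert_min[symmetric]) auto
  ultimately show ?thesis
    using card_image_append_sorted[of "insert m' A" m 1] card_image_append_two_sorted[of A m m'] m assms
    by simp
qed

section \<open>Invariance under order isomorphisms and sums over subsets by size\<close>

lemma descents_above_map:
  assumes "strict_mono_on (insert a (set xs)) f"
  shows "descents_above (f a) (map f xs) = descents_above a xs"
  using assms
proof (induction a xs rule: descents_above.induct)
  case (1 a x y zs)
  then have "strict_mono_on (insert a (set (y # zs))) f"
    by (auto intro: monotone_on_subset)
  with 1 show ?case
    by (simp add: strict_mono_on_less)
qed auto

lemma occs_map:
  assumes "strict_mono_on (set xs) f"
  shows "occs (map f xs) = occs xs"
  using assms
proof (induction xs)
  case (Cons x xs)
  then have "strict_mono_on (set xs) f"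
    by (auto intro: monotone_on_subset)
  with Cons show ?case
    by (simp add: descents_above_map)
qed simp

text \<open>The increasing enumeration of \<open>A\<close> preserves occurrences, so only the size
  of the alphabet matters.\<close>

lemma card_words_lessThan:
  fixes A :: "nat set"
  assumes "finite A"
  shows "card (words c A) = card (words c {..<card A})"
proof -
  obtain h where h: "bij_betw h {..<card A} A" "strict_mono_on {..<card A} h"
    using ex_bij_betw_strict_mono_card[OF assms] by blast
  have inj: "inj_on h {..<card A}" and im: "h ` {..<card A} = A"
    using h(1) by (auto simp: bij_betw_def)
  have "occs (map h xs) = occs xs" if "xs \<in> permutations_of_set {..<card A}" for xs
    using that h(2) permutations_of_setD(1) by (intro occs_map) force
  then have "words c A = map h ` words c {..<card A}"
    using permutations_of_set_image_inj[OF inj] unfolding words_def im by force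
  moreover have "inj_on (map h) (words c {..<card A})"
    using inj by (auto simp: mem_words_iff intro!: inj_on_mapI inj_on_subset[OF inj])
  ultimately show ?thesis
    by (simp add: card_image)
qed

lemma sum_Pow_card:
  fixes f :: "nat \<Rightarrow> 'b::semiring_1"
  assumes "finite A"
  shows "(\<Sum>U\<in>Pow A. f (card U)) = (\<Sum>k\<le>card A. of_nat (card A choose k) * f k)"
proof -
  have "(\<Sum>U\<in>Pow A. f (card U)) = (\<Sum>k\<le>card A. \<Sum>U\<in>{U \<in> Pow A. card U = k}. f (card U))"
    using assms by (intro sum.group[symmetric]) (auto intro: card_mono)
  also have "\<dots> = (\<Sum>k\<le>card A. of_nat (card A choose k) * f k)"
    using n_subsets[OF assms] by (intro sum.cong) (auto simp: Pow_def)
  finally show ?thesis .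
qed

section \<open>Set partitions and permutations\<close>

text \<open>Deleting the block of \<open>m\<close> leaves a partition of some subset
  \<open>U\<close> of \<open>A\<close>, and \<open>U\<close> determines the deleted block as
  \<open>insert m (A - U)\<close>.\<close>

lemma card_partition_on_insert:
  assumes "finite A" "m \<notin> A"
  shows "card {P. partition_on (insert m A) P} = (\<Sum>U\<in>Pow A. card {P. partition_on U P})"
proof -
  let ?f = "\<lambda>(U, P). insert (insert m (A - U)) P"
  let ?S = "SIGMA U:Pow A. {P. partition_on U P}"
  have "inj_on ?f ?S"
  proof (rule inj_onI, clarify)
    fix U P V Q
    assume *: "U \<subseteq> A" "V \<subseteq> A" "partition_on U P" "partition_on V Q"
      and eq: "insert (insert m (A - U)) P = insert (insert m (A - V)) Q"
    \<comment> \<open>The inserted block is the only one containing \<open>m\<close>, so it can be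
      identified and removed on both sides.\<close>
    have "\<forall>X\<in>P. m \<notin> X" "\<forall>X\<in>Q. m \<notin> X"
      using * assms by (auto simp: partition_on_def)
    with eq have "P = Q" by blast
    with * show "U = V \<and> P = Q" by (auto simp: partition_on_def)
  qed
  moreover have "?f ` ?S = {P. partition_on (insert m A) P}"
  proof (intro equalityI subsetI)
    fix R assume "R \<in> ?f ` ?S"
    then obtain U P where *: "U \<subseteq> A" "partition_on U P" "R = insert (insert m (A - U)) P"
      by auto
    then have "disjnt (insert m (A - U)) (\<Union>P)" "insert m A - insert m (A - U) = U"
      using assms by (auto simp: partition_on_def disjnt_def)
    then show "R \<in> {P. partition_on (insert m A) P}"
      using * by (auto simp: partition_on_insert)
  next
    fix R assume "R \<in> {P. partition_on (insert m A) P}"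
    then have R: "partition_on (insert m A) R" by simp
    then obtain X where X: "X \<in> R" "m \<in> X"
      by (auto simp: partition_on_def)
    have d: "disjnt X (\<Union>(R - {X}))"
      using R X by (auto simp: partition_on_def pairwise_def disjnt_def)
    then have "partition_on (insert m A - X) (R - {X})" "X \<subseteq> insert m A"
      using R X partition_on_insert[OF d, of "insert m A"] by (auto simp: insert_absorb)
    moreover have "insert m (A - (insert m A - X)) = X"
      using X \<open>X \<subseteq> insert m A\<close> by auto
    ultimately show "R \<in> ?f ` ?S"
      using X by (intro image_eqI[of _ _ "(insert m A - X, R - {X})"]) auto
  qed
  ultimately have "card {P. partition_on (insert m A) P} = card ?S"
    by (metis card_image)
  also have "\<dots> = (\<Sum>U\<in>Pow A. card {P. partition_on U P})"
    using assms finite_subset by (subst card_SigmaI) (auto intro!: finitely_many_partition_on)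
  finally show ?thesis .
qed

text \<open>Both sides are 1 on the empty set and obey the same recurrence when the minimum is split
  off.\<close>

lemma card_partition_on_eq_card_words_0:
  fixes A :: "'a::linorder set"
  assumes "finite A"
  shows "card {P. partition_on A P} = card (words 0 A)"
  using assms
proof (induction A rule: finite_psubset_induct)
  case (psubset A)
  show ?case
  proof (cases "A = {}")
    case True
    then have "words 0 A = {[]}"
      by (auto simp: mem_words_iff)
    with True show ?thesis
      by (simp add: partition_on_empty)
  next
    case False
    define m where "m = Min A"
    define B where "B = A - {m}"
    have "m \<in> A"
      using psubset.hyps False by (simp add: m_def)
    have B: "finite B" "\<forall>x\<in>B. m < x" "A = insert m B" "m \<notin> B"
      using psubset.hyps \<open>m \<in> A\<close> by (auto simp: B_def m_def less_le)
    have "card {P. partition_on U P} = card (words 0 U)" if "U \<in> Pow B" for U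
      using that B by (intro psubset.IH) auto
    then show ?thesis
      using card_partition_on_insert[OF B(1,4)] card_words_0_insert_min[OF B(1,2)] B(3) by simp
  qed
qed

lemma Bell_eq: "Bell k = card (words 0 {..<k})"
  using card_words_lessThan[of "{1..k}" 0]
  by (simp add: Bell_def card_partition_on_eq_card_words_0)

section \<open>From words to index pairs and permutations\<close>

lemma descents_above_eq_card:
  "descents_above a xs = card {j. Suc j < length xs \<and> a < xs ! Suc j \<and> xs ! Suc j < xs ! j}"
proof (induction a xs rule: descents_above.induct)
  case (1 a x y zs)
  let ?D = "\<lambda>xs. {j. Suc j < length xs \<and> a < xs ! Suc j \<and> xs ! Suc j < xs ! j}"
  have "?D (x # y # zs) = {j. j = 0 \<and> a < y \<and> y < x} \<union> Suc ` ?D (y # zs)"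
    (is "?L = ?R")
  proof (rule set_eqI)
    show "j \<in> ?L \<longleftrightarrow> j \<in> ?R" for j
      by (cases j) auto
  qed
  moreover have "finite (?D (y # zs))"
    by (rule finite_subset[of _ "{..<length (y # zs)}"]) auto
  moreover have "{j. j = 0 \<and> a < y \<and> y < x} \<inter> Suc ` ?D (y # zs) = {}"
    by auto
  moreover have "card (Suc ` ?D (y # zs)) = card (?D (y # zs))"
    by (simp add: card_image)
  moreover have "finite {j::nat. j = 0 \<and> a < y \<and> y < x}"
    by simp
  ultimately have "card (?D (x # y # zs)) = card {j::nat. j = 0 \<and> a < y \<and> y < x} + card (?D (y # zs))"
    by (simp only: card_Un_disjoint finite_imageI)
  with 1 show ?case by simp
qed auto

lemma occs_eq_card:
  "occs xs = card {(i, j). i < j \<and> Suc j < length xs \<and> xs ! i < xs ! Suc j \<and> xs ! Suc j < xs ! j}"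
proof (induction xs)
  case (Cons x xs)
  let ?O = "\<lambda>xs. {(i, j). i < j \<and> Suc j < length xs \<and> xs ! i < xs ! Suc j \<and> xs ! Suc j < xs ! j}"
  let ?D = "{j. Suc j < length xs \<and> x < xs ! Suc j \<and> xs ! Suc j < xs ! j}"
  \<comment> \<open>Pairs with first index 0 are the descents above \<open>x\<close>; all others are
    shifted occurrences in \<open>xs\<close>.\<close>
  have "?O (x # xs) = (\<lambda>j. (0, Suc j)) ` ?D \<union> map_prod Suc Suc ` ?O xs"
    (is "?L = ?R")
  proof (rule set_eqI, clarify)
    show "(i, j) \<in> ?L \<longleftrightarrow> (i, j) \<in> ?R" for i j
      by (cases i; cases j) auto
  qed
  moreover have "finite ?D" "finite (?O xs)"
    by (rule finite_subset[of _ "{..<length xs}"], auto)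
       (rule finite_subset[of _ "{..<length xs} \<times> {..<length xs}"], auto)
  moreover have "(\<lambda>j. (0, Suc j)) ` ?D \<inter> map_prod Suc Suc ` ?O xs = {}"
    by auto
  moreover have "card ((\<lambda>j. (0::nat, Suc j)) ` ?D) = card ?D"
    "card (map_prod Suc Suc ` ?O xs) = card (?O xs)"
    by (auto intro!: card_image simp: inj_on_def)
  ultimately have "card (?O (x # xs)) = card ?D + card (?O xs)"
    by (simp only: card_Un_disjoint finite_imageI)
  with Cons show ?case by (simp add: descents_above_eq_card)
qed simp

text \<open>Applying \<open>Suc\<close> to both indices passes from list positions, which start at
  0, to permutation indices, which start at 1.\<close>

lemma card_occ_1_32: "card (occ_1_32 n \<pi>) = occs (map \<pi> [1..<Suc n])"
proof -
  let ?xs = "map \<pi> [1..<Suc n]"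
  let ?O = "{(i, j). i < j \<and> Suc j < length ?xs \<and> ?xs ! i < ?xs ! Suc j \<and> ?xs ! Suc j < ?xs ! j}"
  have "occ_1_32 n \<pi> = map_prod Suc Suc ` ?O"
  proof (rule set_eqI, clarify)
    show "(i, j) \<in> occ_1_32 n \<pi> \<longleftrightarrow> (i, j) \<in> map_prod Suc Suc ` ?O" for i j
      by (cases i; cases j) (auto simp: occ_1_32_def simp del: upt_Suc)
  qed
  moreover have "card (map_prod Suc Suc ` ?O) = card ?O"
    by (rule card_image) (auto simp: inj_on_def)
  ultimately show ?thesis
    by (simp only: occs_eq_card)
qed

lemma v1_eq: "v1 n = card (words 1 {..<n})"
proof -
  let ?f = "\<lambda>\<pi>::nat \<Rightarrow> nat. map \<pi> [1..<Suc n]"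
  have inj: "inj_on ?f {\<pi>. \<pi> permutes {1..n}}"
  proof (rule inj_onI, clarify)
    fix \<pi> \<sigma> :: "nat \<Rightarrow> nat"
    assume *: "\<pi> permutes {1..n}" "\<sigma> permutes {1..n}" "?f \<pi> = ?f \<sigma>"
    \<comment> \<open>Both functions are the identity outside \<open>{1..n}\<close>, so the lists
      determine them.\<close>
    show "\<pi> = \<sigma>"
    proof
      fix x show "\<pi> x = \<sigma> x"
        using * by (cases "x \<in> {1..n}") (auto simp: permutes_not_in simp del: upt_Suc)
    qed
  qed
  \<comment> \<open>Surjectivity onto words comes from counting: both sets have
    \<open>fact n\<close> elements.\<close>
  have "?f ` {\<pi>. \<pi> permutes {1..n}} = permutations_of_set {1..n}"
  proof (rule card_subset_eq)
    show "?f ` {\<pi>. \<pi> permutes {1..n}} \<subseteq> permutations_of_set {1..n}"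
      by (auto simp: permutations_of_set_def distinct_map permutes_inj_on permutes_image
          atLeastLessThanSuc_atLeastAtMost simp del: upt_Suc)
    show "card (?f ` {\<pi>. \<pi> permutes {1..n}}) = card (permutations_of_set {1..n})"
      using inj by (simp add: card_image card_permutations del: upt_Suc)
  qed simp
  then have "words 1 {1..n} = ?f ` {\<pi>. \<pi> permutes {1..n} \<and> card (occ_1_32 n \<pi>) = 1}"
    by (auto simp: words_def card_occ_1_32 simp del: upt_Suc)
  moreover have "inj_on ?f {\<pi>. \<pi> permutes {1..n} \<and> card (occ_1_32 n \<pi>) = 1}"
    by (rule inj_on_subset[OF inj]) auto
  ultimately have "card (words 1 {1..n}) = v1 n"
    unfolding v1_def by (simp add: card_image del: upt_Suc)
  then show ?thesis
    using card_words_lessThan[of "{1..n}" 1] by simp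
qed

lemma v1_0: "v1 0 = 0"
proof -
  have "words 1 {..<0::nat} = {}"
    by (auto simp: mem_words_iff)
  then show ?thesis by (simp add: v1_eq)
qed

lemma v1_1: "v1 1 = 0"
proof -
  have "occs xs = 0" if "distinct xs" "set xs = {0}" for xs :: "nat list"
  proof -
    have "length xs = 1"
      using that distinct_card by force
    then show ?thesis by (auto simp: length_Suc_conv)
  qed
  then have "words 1 {..<1::nat} = {}"
    by (auto simp: mem_words_iff lessThan_Suc)
  then show ?thesis by (simp add: v1_eq)
qed

section \<open>The recurrence in numbers\<close>

lemma v1_Suc_Suc:
  "v1 (Suc (Suc n)) = (\<Sum>k\<le>Suc n. (Suc n choose k) * v1 k) + (\<Sum>k<n. (n choose k) * Bell (Suc k))"
proof -
  \<comment> \<open>The alphabet of size \<open>n + 2\<close> is split as 0, 1 and \<open>A\<close>,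
    with 0 and 1 in the roles of \<open>m\<close> and \<open>m'\<close>.\<close>
  define A where "A = {2..<Suc (Suc n)}"
  have A: "finite A" "card A = n" "\<forall>x\<in>A. 1 < x"
    by (auto simp: A_def)
  have w: "card (words 1 U) = v1 (card U)" "card (words 0 U) = Bell (card U)" if "finite U" for U :: "nat set"
    using card_words_lessThan[OF that] by (simp_all only: v1_eq Bell_eq)
  have fin: "finite U" if "U \<in> Pow A - {A}" for U
    using that A(1) by (auto intro: finite_subset)
  have 1: "(\<Sum>U\<in>Pow (insert 1 A). card (words 1 U)) = (\<Sum>U\<in>Pow (insert 1 A). v1 (card U))"
    using A(1) by (intro sum.cong refl w(1)) (auto intro: finite_subset)
  have "(\<Sum>V\<in>Pow A - {A}. card (words 0 (insert 1 V))) = (\<Sum>V\<in>Pow A - {A}. Bell (Suc (card V)))"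
  proof (rule sum.cong)
    fix V assume V: "V \<in> Pow A - {A}"
    then have "1 \<notin> V" using A by auto
    then show "card (words 0 (insert 1 V)) = Bell (Suc (card V))"
      using w(2)[of "insert 1 V"] fin[OF V] by simp
  qed simp
  \<comment> \<open>Including \<open>V = A\<close> allows grouping all subsets by size; its term
    \<open>Bell (Suc n)\<close> is the one for \<open>k = n\<close> and cancels.\<close>
  moreover have "(\<Sum>V\<in>Pow A. Bell (Suc (card V))) =
      (\<Sum>V\<in>Pow A - {A}. Bell (Suc (card V))) + Bell (Suc n)"
    using A by (subst sum.remove[of _ A]) auto
  moreover have "(\<Sum>V\<in>Pow A. Bell (Suc (card V))) =
      (\<Sum>k<n. (n choose k) * Bell (Suc k)) + Bell (Suc n)"
    using sum_Pow_card[OF A(1), of "\<lambda>k. Bell (Suc k)"] A by (simp flip: lessThan_Suc_atMost)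
  ultimately have 2: "(\<Sum>V\<in>Pow A - {A}. card (words 0 (insert 1 V))) =
      (\<Sum>k<n. (n choose k) * Bell (Suc k))"
    by simp
  have "1 \<notin> A" using A by auto
  then have "card (insert 1 A) = Suc n" using A by simp
  moreover have "card (insert 0 (insert 1 A)) = Suc (Suc n)"
    using A \<open>1 \<notin> A\<close> by (auto simp: card_insert_if)
  then have "v1 (Suc (Suc n)) = card (words 1 (insert 0 (insert 1 A)))"
    using w(1)[of "insert 0 (insert 1 A)"] A by simp
  ultimately show ?thesis
    using card_words_1_insert_min[of A 0 1] A 1 2 sum_Pow_card[of "insert 1 A" v1] by simp
qed

theorem theorem3:
  shows "v1 0 = 0 \<and>
    (\<forall>n. v1 (n + 1) = v1 n +
      (\<Sum>k = 1..n - 1. (n choose k) * v1 k + ((n - 1) choose (k - 1)) * Bell k))"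
proof (intro conjI allI)
  show "v1 0 = 0" by (rule v1_0)
  show "v1 (n + 1) = v1 n +
      (\<Sum>k = 1..n - 1. (n choose k) * v1 k + ((n - 1) choose (k - 1)) * Bell k)" for n
  proof (cases n)
    case 0
    \<comment> \<open>Truncated subtraction makes the range \<open>{1..0}\<close>, so the sum is
      empty.\<close>
    then show ?thesis using v1_0 v1_1 by simp
  next
    case (Suc m)
    have "(\<Sum>k\<le>n. (n choose k) * v1 k) = v1 n + (\<Sum>k<Suc m. (n choose k) * v1 k)"
      by (simp add: Suc flip: lessThan_Suc_atMost)
    \<comment> \<open>The term for \<open>k = 0\<close> vanishes because
      \<open>v1 0 = 0\<close>.\<close>
    also have "(\<Sum>k<Suc m. (n choose k) * v1 k) = (\<Sum>k = 1..m. (n choose k) * v1 k)"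
      by (simp add: sum.lessThan_Suc_shift v1_0 sum.atLeast1_atMost_eq del: sum.lessThan_Suc)
    finally have "v1 (n + 1) = v1 n + (\<Sum>k = 1..m. (n choose k) * v1 k) +
        (\<Sum>k<m. (m choose k) * Bell (Suc k))"
      using v1_Suc_Suc[of m] by (simp add: Suc)
    also have "(\<Sum>k<m. (m choose k) * Bell (Suc k)) = (\<Sum>k = 1..m. (m choose (k - 1)) * Bell k)"
      by (simp add: sum.atLeast1_atMost_eq)
    finally show ?thesis
      by (simp add: Suc sum.distrib)
  qed
qed

end
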